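(* Let $G$ be a semigroup and let $R$ be an associative, not necessarily unital, $G$-graded ring, $R=\bigoplus_{g\in G}R_g$, such that if $G$ has a zero element $\theta$, then $R_\theta=\{0\}$. Suppose that $G$ has a non-zero idempotent $e$ such that $G$ is cancellative at $e$, that the non-zero elements of $eGe$ form a hypercentral group, and that $R_e$ contains a non-zero idempotent $f$. Then $R$ is simple if and only if $R$ is graded simple and the center of the corner subring $f R_{eGe} f$ is a field.
   Context: A semigroup is a non-empty set with an associative binary operation. A zero element of a semigroup $G$ is an element $\theta\in G$ with $\theta g=g\theta=\theta$ for all $g\in G$; an element of $G$ is called non-zero if it is not a zero element (if $G$ has no zero element, every element is non-zero, and conditions of the form "$\neq\theta$" hold automatically). Rings are associative but not necessarily unital. A ring $R$ is $G$-graded if for each $g\in G$ there is an additive subgroup $R_g$ of $R$ such that $R=\bigoplus_{g\in G}R_g$ and $R_gR_h\subseteq R_{gh}$ for all $g,h\in G$. For a subsemigroup $H$ of $G$, $R_H=\bigoplus_{g\in H}R_g$. Here $eGe=\{ege\mid g\in G\}$ and $f R_{eGe} f=\{frf\mid r\in R_{eGe}\}$. Ideals are two-sided. An ideal $I$ of $R$ is graded if $I=\bigoplus_{g\in G}(I\cap R_g)$. The ring $R$ is simple if $R$ and $\{0\}$ are its only ideals, and graded simple if $R$ and $\{0\}$ are its only graded ideals. For a non-zero idempotent $e\in G$, $G$ is cancellative at $e$ if for all $a,b,x,y\in G$, a relation of the form $eaxbe=eaybe\neq\theta$ implies $x=y$. A group is hypercentral if each of its non-trivial factor groups has non-trivial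 center. *)

theory Defs
  imports "HOL-Algebra.Elementary_Groups" "HOL-Algebra.Ring" "HOL-Library.Groups_Big_Fun"
begin

text \<open>
  The grading semigroup is a type of class \<open>semigroup_mult\<close>, and the graded ring is a type of
  class \<open>ring\<close> (associative, no unit assumed). Groups and rings that live on subsets of these
  types are HOL-Algebra records.
\<close>

section \<open>Semigroups\<close>

definition is_zero :: "'g::semigroup_mult \<Rightarrow> bool"
  where "is_zero \<theta> \<longleftrightarrow> (\<forall>g. \<theta> * g = \<theta> \<and> g * \<theta> = \<theta>)"

definition local_subsemigroup :: "'g::semigroup_mult \<Rightarrow> 'g set"
  where "local_subsemigroup e = {e * g * e | g. True}"

definition cancellative_at :: "'g::semigroup_mult \<Rightarrow> bool"
  where "cancellative_at e \<longleftrightarrow>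
    (\<forall>a b x y. e * a * x * b * e = e * a * y * b * e \<and> \<not> is_zero (e * a * x * b * e) \<longrightarrow> x = y)"

text \<open>
  If \<open>e\<close> is an idempotent that lies in the carrier and the carrier is a group under
  multiplication, then \<open>e\<close> is necessarily the identity of that group.
\<close>

definition nonzero_local_monoid :: "'g::semigroup_mult \<Rightarrow> 'g monoid"
  where "nonzero_local_monoid e =
    \<lparr>carrier = {x \<in> local_subsemigroup e. \<not> is_zero x}, mult = (*), one = e\<rparr>"


section \<open>Centers and hypercentral groups\<close>

text \<open>This depends only on the multiplication, so it applies both to groups and to rings.\<close>

definition center :: "('a, 'b) monoid_scheme \<Rightarrow> 'a set"
  where "center M = {z \<in> carrier M. \<forall>x \<in> carrier M. z \<otimes>\<^bsub>M\<^esub> x = x \<otimes>\<^bsub>M\<^esub> z}"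

definition hypercentral_group :: "('a, 'b) monoid_scheme \<Rightarrow> bool"
  where "hypercentral_group G \<longleftrightarrow> group G \<and>
    (\<forall>N. N \<lhd> G \<and> \<not> trivial_group (G Mod N) \<longrightarrow> center (G Mod N) \<noteq> {\<one>\<^bsub>G Mod N\<^esub>})"


section \<open>Ideals and gradings\<close>

definition add_subgroup :: "'r::ab_group_add set \<Rightarrow> bool"
  where "add_subgroup A \<longleftrightarrow> 0 \<in> A \<and> (\<forall>x\<in>A. \<forall>y\<in>A. x + y \<in> A) \<and> (\<forall>x\<in>A. - x \<in> A)"

definition two_sided_ideal :: "'r::ring set \<Rightarrow> bool"
  where "two_sided_ideal I \<longleftrightarrow> add_subgroup I \<and> (\<forall>r. \<forall>x\<in>I. r * x \<in> I \<and> x * r \<in> I)"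

definition finsupp_families :: "('i \<Rightarrow> 'r::ab_group_add set) \<Rightarrow> 'i set \<Rightarrow> ('i \<Rightarrow> 'r) set"
  where "finsupp_families M A =
    {c. finite {i. c i \<noteq> 0} \<and> (\<forall>i\<in>A. c i \<in> M i) \<and> (\<forall>i. i \<notin> A \<longrightarrow> c i = 0)}"

definition sum_of_family :: "('i \<Rightarrow> 'r::ab_group_add set) \<Rightarrow> 'i set \<Rightarrow> 'r set"
  where "sum_of_family M A = Sum_any ` finsupp_families M A"

text \<open>
  \<open>X\<close> is the internal direct sum of the subgroups \<open>M i\<close>, \<open>i \<in> A\<close>: summation is a bijection
  from the external direct sum onto \<open>X\<close>.
\<close>

definition internal_direct_sum :: "('i \<Rightarrow> 'r::ab_group_add set) \<Rightarrow> 'i set \<Rightarrow> 'r set \<Rightarrow> bool"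
  where "internal_direct_sum M A X \<longleftrightarrow>
    (\<forall>i\<in>A. add_subgroup (M i)) \<and> bij_betw Sum_any (finsupp_families M A) X"

definition grading :: "('g::semigroup_mult \<Rightarrow> 'r::ring set) \<Rightarrow> bool"
  where "grading R \<longleftrightarrow> internal_direct_sum R UNIV UNIV \<and>
    (\<forall>g h. \<forall>x \<in> R g. \<forall>y \<in> R h. x * y \<in> R (g * h))"

definition graded_ideal :: "('g::semigroup_mult \<Rightarrow> 'r::ring set) \<Rightarrow> 'r set \<Rightarrow> bool"
  where "graded_ideal R I \<longleftrightarrow>
    two_sided_ideal I \<and> internal_direct_sum (\<lambda>g. I \<inter> R g) UNIV I"

definition simple_ring :: "'r::ring itself \<Rightarrow> bool"
  where "simple_ring _ \<longleftrightarrow> (\<forall>I :: 'r set. two_sided_ideal I \<longrightarrow> I = {0} \<or> I = UNIV)"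

definition graded_simple :: "('g::semigroup_mult \<Rightarrow> 'r::ring set) \<Rightarrow> bool"
  where "graded_simple R \<longleftrightarrow> (\<forall>I. graded_ideal R I \<longrightarrow> I = {0} \<or> I = UNIV)"

text \<open>The corner \<open>f S f\<close> of a subring \<open>S\<close>, whose identity is the idempotent \<open>f\<close>.\<close>

definition corner_ring :: "'r::ring \<Rightarrow> 'r set \<Rightarrow> 'r ring"
  where "corner_ring f S =
    \<lparr>carrier = {f * r * f | r. r \<in> S}, mult = (*), one = f, zero = 0, add = (+)\<rparr>"

definition center_ring :: "'a ring \<Rightarrow> 'a ring"
  where "center_ring R = R\<lparr>carrier := center R\<rparr>"

end

theory Submission
  imports Defs
begin

text \<open>
  Write \<open>H\<close> for the group of non-zero elements of \<open>eGe\<close>. Cancellativity at \<open>e\<close> makes \<open>f R f\<close> a unital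
  ring graded by \<open>H\<close>, equal to the corner in question, and makes every set of the form
  \<open>{x. f R x R f \<subseteq> I}\<close>, read componentwise, a graded ideal. If \<open>R\<close> is graded simple, it follows that
  each non-zero ideal of \<open>R\<close> meets \<open>f R f\<close>, and that homogeneous elements of \<open>f R f\<close> generate \<open>f\<close>.

  By Zorn's lemma there is a maximal normal subgroup \<open>N\<close> of \<open>H\<close> such that every non-zero element of
  \<open>f R f\<close> supported in a coset of \<open>N\<close> generates \<open>f\<close>. In the \<open>H / N\<close>-grading, take an element of
  minimal support in an ideal among those supported in a coset of the center of \<open>H / N\<close>. One can
  normalize it to have component \<open>f\<close> in degree \<open>1\<close>; then it is central, hence a unit. So the
  preimage of the center of \<open>H / N\<close> equals \<open>N\<close>, and hypercentrality gives \<open>N = H\<close>.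

  Conversely, if \<open>R\<close> is simple and \<open>z \<noteq> 0\<close> is central in \<open>f R f\<close>, then \<open>{x. f R x R f \<subseteq> z (f R f)}\<close> is
  an ideal containing \<open>z\<close>, so it contains \<open>f\<close>, and \<open>z\<close> is invertible.
\<close>

section \<open>Centers of groups\<close>

context group
begin

lemma inv_mult_cancel: "\<lbrakk>k \<in> carrier G; h \<in> carrier G\<rbrakk> \<Longrightarrow> inv k \<otimes> (k \<otimes> h) = h"
  and mult_inv_cancel: "\<lbrakk>k \<in> carrier G; h \<in> carrier G\<rbrakk> \<Longrightarrow> k \<otimes> (inv k \<otimes> h) = h"
  by (simp_all add: m_assoc[symmetric])

lemma center_carrier: "z \<in> center G \<Longrightarrow> z \<in> carrier G"
  and center_commute: "\<lbrakk>z \<in> center G; h \<in> carrier G\<rbrakk> \<Longrightarrow> z \<otimes> h = h \<otimes> z"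
  by (simp_all add: center_def)

lemma one_mem_center: "\<one> \<in> center G"
  by (simp add: center_def)

lemma inv_mem_center:
  assumes z: "z \<in> center G"
  shows "inv z \<in> center G"
proof -
  have zK: "z \<in> carrier G" using z by (rule center_carrier)
  have "inv z \<otimes> h = h \<otimes> inv z" if h: "h \<in> carrier G" for h
  proof -
    have "inv z \<otimes> h = inv z \<otimes> (h \<otimes> z) \<otimes> inv z" using h zK by (simp add: m_assoc)
    also have "\<dots> = inv z \<otimes> (z \<otimes> h) \<otimes> inv z" using center_commute[OF z h] by simp
    also have "\<dots> = h \<otimes> inv z" using h zK by (simp add: inv_mult_cancel)
    finally show ?thesis .
  qed
  then show ?thesis using zK by (simp add: center_def)
qed

lemma mult_mem_center:
  assumes z: "z \<in> center G" and w: "w \<in> center G"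
  shows "z \<otimes> w \<in> center G"
proof -
  have K: "z \<in> carrier G" "w \<in> carrier G" using z w by (auto intro: center_carrier)
  have "z \<otimes> w \<otimes> h = h \<otimes> (z \<otimes> w)" if h: "h \<in> carrier G" for h
  proof -
    have "z \<otimes> w \<otimes> h = z \<otimes> (h \<otimes> w)" using h K center_commute[OF w h] by (simp add: m_assoc)
    also have "\<dots> = h \<otimes> z \<otimes> w" using h K center_commute[OF z h] by (simp add: m_assoc[symmetric])
    finally show ?thesis using h K by (simp add: m_assoc)
  qed
  then show ?thesis using K by (simp add: center_def)
qed

end

section \<open>Unital rings graded by a group\<close>

text \<open>
  The ring is the subset \<open>S\<close> of a non-unital ring, with identity \<open>f\<close>; the map \<open>p k\<close> is the
  projection onto the component of degree \<open>k\<close>.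
\<close>

locale group_graded_corner = group K for K :: "('k, 'm) monoid_scheme" (structure) +
  fixes S :: "'r::ring set" and f :: 'r and p :: "'k \<Rightarrow> 'r \<Rightarrow> 'r"
  assumes S_zero: "0 \<in> S"
    and S_add: "\<lbrakk>x \<in> S; y \<in> S\<rbrakk> \<Longrightarrow> x + y \<in> S"
    and S_uminus: "x \<in> S \<Longrightarrow> - x \<in> S"
    and S_mult: "\<lbrakk>x \<in> S; y \<in> S\<rbrakk> \<Longrightarrow> x * y \<in> S"
    and S_unit: "f \<in> S"
    and unit_left: "x \<in> S \<Longrightarrow> f * x = x"
    and unit_right: "x \<in> S \<Longrightarrow> x * f = x"
    and unit_nonzero: "f \<noteq> 0"
    and p_closed: "x \<in> S \<Longrightarrow> p k x \<in> S"
    and p_add: "\<lbrakk>x \<in> S; y \<in> S\<rbrakk> \<Longrightarrow> p k (x + y) = p k x + p k y"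
    and p_finite: "x \<in> S \<Longrightarrow> finite {k. p k x \<noteq> 0}"
    and p_carrier: "\<lbrakk>x \<in> S; p k x \<noteq> 0\<rbrakk> \<Longrightarrow> k \<in> carrier K"
    and p_sum: "x \<in> S \<Longrightarrow> (\<Sum>k | p k x \<noteq> 0. p k x) = x"
    and p_p: "x \<in> S \<Longrightarrow> p k (p l x) = (if k = l then p l x else 0)"
    and p_mult: "\<lbrakk>x \<in> S; y \<in> S; k \<in> carrier K; l \<in> carrier K\<rbrakk>
      \<Longrightarrow> p (k \<otimes> l) (p k x * p l y) = p k x * p l y"
    and p_unit: "p \<one> f = f"
begin

definition supp :: "'r \<Rightarrow> 'k set"
  where "supp x = {k. p k x \<noteq> 0}"

text \<open>Additive inverses come from multiplication by \<open>- f\<close>, an element of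
  \<open>S\<close>.\<close>

definition ideal_of :: "'r set \<Rightarrow> bool"
  where "ideal_of I \<longleftrightarrow> I \<subseteq> S \<and> 0 \<in> I \<and> (\<forall>x\<in>I. \<forall>y\<in>I. x + y \<in> I) \<and>
    (\<forall>x\<in>I. \<forall>s\<in>S. s * x \<in> I \<and> x * s \<in> I)"

lemma supp_finite: "x \<in> S \<Longrightarrow> finite (supp x)"
  by (simp add: supp_def p_finite)

lemma supp_carrier: "x \<in> S \<Longrightarrow> supp x \<subseteq> carrier K"
  by (auto simp: supp_def p_carrier)

lemma S_sum: "(\<And>i. i \<in> A \<Longrightarrow> g i \<in> S) \<Longrightarrow> sum g A \<in> S"
  by (induction A rule: infinite_finite_induct) (auto simp: S_zero S_add)

lemma p_zero: "p k 0 = 0"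
  using p_add[of 0 0 k] S_zero by simp

lemma p_uminus: "x \<in> S \<Longrightarrow> p k (- x) = - p k x"
  using p_add[of x "- x" k] S_uminus[of x] by (simp add: p_zero eq_neg_iff_add_eq_0 add.commute)

lemma p_diff: "\<lbrakk>x \<in> S; y \<in> S\<rbrakk> \<Longrightarrow> p k (x - y) = p k x - p k y"
  using p_add[of x "- y" k] S_uminus[of y] by (simp add: p_uminus)

lemma p_of_sum: "(\<And>i. i \<in> A \<Longrightarrow> g i \<in> S) \<Longrightarrow> p k (sum g A) = (\<Sum>i\<in>A. p k (g i))"
proof (induction A rule: infinite_finite_induct)
  case (insert a A)
  then show ?case by (simp add: p_add S_sum)
qed (auto simp: p_zero)

lemma p_outside: "\<lbrakk>x \<in> S; k \<notin> carrier K\<rbrakk> \<Longrightarrow> p k x = 0"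
  using p_carrier by blast

lemma p_eqI: "\<lbrakk>x \<in> S; y \<in> S; \<And>k. k \<in> carrier K \<Longrightarrow> p k x = p k y\<rbrakk> \<Longrightarrow> x = y"
proof -
  assume a: "x \<in> S" "y \<in> S" "\<And>k. k \<in> carrier K \<Longrightarrow> p k x = p k y"
  have "p k x = p k y" for k
    using a p_outside by (cases "k \<in> carrier K") auto
  then have "(\<Sum>k | p k x \<noteq> 0. p k x) = (\<Sum>k | p k y \<noteq> 0. p k y)" by simp
  then show "x = y" unfolding p_sum[OF a(1)] p_sum[OF a(2)] .
qed

lemma supp_p: "x \<in> S \<Longrightarrow> supp (p k x) \<subseteq> {k}"
  by (auto simp: supp_def p_p split: if_splits)

lemma ideal_ofD:
  assumes "ideal_of I"
  shows "x \<in> I \<Longrightarrow> x \<in> S" "0 \<in> I" "\<lbrakk>x \<in> I; y \<in> I\<rbrakk> \<Longrightarrow> x + y \<in> I"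
    "\<lbrakk>x \<in> I; s \<in> S\<rbrakk> \<Longrightarrow> s * x \<in> I" "\<lbrakk>x \<in> I; s \<in> S\<rbrakk> \<Longrightarrow> x * s \<in> I"
  using assms by (auto simp: ideal_of_def)

lemma ideal_of_diff: "\<lbrakk>ideal_of I; x \<in> I; y \<in> I\<rbrakk> \<Longrightarrow> x - y \<in> I"
  using ideal_ofD(3)[of I x "- f * y"] ideal_ofD(4)[of I y "- f"] ideal_ofD(1)[of I y]
    S_uminus[OF S_unit] by (simp add: unit_left)

section \<open>Products with homogeneous factors\<close>

lemma p_mult_eq_0:
  assumes "x \<in> S" "y \<in> S" "k \<in> carrier K" "l \<in> carrier K" "m \<noteq> k \<otimes> l"
  shows "p m (p k x * p l y) = 0"
  using p_mult[OF assms(1-4)] p_p[of "p k x * p l y" m "k \<otimes> l"] assms(1,2,5)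
  by (simp add: S_mult p_closed)

text \<open>Left translation by \<open>k\<close> is injective in a group, so only the component of
  \<open>y\<close> in degree \<open>inv k \<otimes> m\<close> reaches degree
  \<open>m\<close>.\<close>

lemma p_homogeneous_mult:
  assumes x: "x \<in> S" and y: "y \<in> S" and k: "k \<in> carrier K" and m: "m \<in> carrier K"
  shows "p m (p k x * y) = p k x * p (inv k \<otimes> m) y"
proof -
  let ?l = "inv k \<otimes> m"
  have km: "k \<otimes> ?l = m" using k m by (simp add: m_assoc[symmetric])
  have "p k x * y = (\<Sum>l\<in>supp y. p k x * p l y)"
    using p_sum[OF y] by (simp add: supp_def sum_distrib_left[symmetric])
  then have "p m (p k x * y) = (\<Sum>l\<in>supp y. p m (p k x * p l y))"
    using p_of_sum[of "supp y" "\<lambda>l. p k x * p l y" m] x y S_mult p_closed by simp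
  also have "\<dots> = (\<Sum>l\<in>supp y. if l = ?l then p k x * p l y else 0)"
  proof (rule sum.cong[OF refl])
    fix l assume "l \<in> supp y"
    then have l: "l \<in> carrier K" using supp_carrier[OF y] by blast
    have "l \<noteq> ?l \<Longrightarrow> m \<noteq> k \<otimes> l" using k l by (auto simp: inv_mult_cancel)
    then show "p m (p k x * p l y) = (if l = ?l then p k x * p l y else 0)"
      using p_mult[OF x y k l] p_mult_eq_0[OF x y k l] km by auto
  qed
  also have "\<dots> = p k x * p ?l y"
    using supp_finite[OF y] by (auto simp: sum.delta' supp_def)
  finally show ?thesis .
qed

lemma p_mult_homogeneous:
  assumes x: "x \<in> S" and y: "y \<in> S" and k: "k \<in> carrier K" and m: "m \<in> carrier K"
  shows "p m (y * p k x) = p (m \<otimes> inv k) y * p k x"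
proof -
  let ?l = "m \<otimes> inv k"
  have km: "?l \<otimes> k = m" using k m by (simp add: m_assoc)
  have "y * p k x = (\<Sum>l\<in>supp y. p l y * p k x)"
    using p_sum[OF y] by (simp add: supp_def sum_distrib_right[symmetric])
  then have "p m (y * p k x) = (\<Sum>l\<in>supp y. p m (p l y * p k x))"
    using p_of_sum[of "supp y" "\<lambda>l. p l y * p k x" m] x y S_mult p_closed by simp
  also have "\<dots> = (\<Sum>l\<in>supp y. if l = ?l then p l y * p k x else 0)"
  proof (rule sum.cong[OF refl])
    fix l assume "l \<in> supp y"
    then have l: "l \<in> carrier K" using supp_carrier[OF y] by blast
    have "l \<noteq> ?l \<Longrightarrow> m \<noteq> l \<otimes> k" using k l by (auto simp: m_assoc)
    then show "p m (p l y * p k x) = (if l = ?l then p l y * p k x else 0)"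
      using p_mult[OF y x l k] p_mult_eq_0[OF y x l k] km by auto
  qed
  also have "\<dots> = p ?l y * p k x"
    using supp_finite[OF y] by (auto simp: sum.delta' supp_def)
  finally show ?thesis .
qed

lemma supp_mult:
  assumes x: "x \<in> S" and y: "y \<in> S"
  shows "supp (x * y) \<subseteq> supp x <#> supp y"
proof
  fix m assume m: "m \<in> supp (x * y)"
  then have mK: "m \<in> carrier K" using supp_carrier S_mult x y by blast
  have "x * y = (\<Sum>k\<in>supp x. p k x * y)"
    using p_sum[OF x] by (simp add: supp_def sum_distrib_right[symmetric])
  then have "p m (x * y) = (\<Sum>k\<in>supp x. p m (p k x * y))"
    using p_of_sum[of "supp x" "\<lambda>k. p k x * y" m] x y S_mult p_closed by simp
  then obtain k where k: "k \<in> supp x" "p m (p k x * y) \<noteq> 0"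
    using m by (metis (mono_tags, lifting) mem_Collect_eq sum.neutral supp_def)
  have kK: "k \<in> carrier K" using supp_carrier x k by blast
  have "inv k \<otimes> m \<in> supp y"
    using p_homogeneous_mult[OF x y kK mK] k(2) by (auto simp: supp_def)
  moreover have "m = k \<otimes> (inv k \<otimes> m)" using kK mK by (simp add: m_assoc[symmetric])
  ultimately show "m \<in> supp x <#> supp y" using k(1) unfolding set_mult_def by blast
qed

text \<open>Every element of \<open>S\<close> is the sum of its components, so absorption can be
  tested on homogeneous factors. This suits sets that are described degree by degree.\<close>

lemma ideal_ofI_homogeneous:
  assumes "I \<subseteq> S" "0 \<in> I" and add: "\<And>x y. \<lbrakk>x \<in> I; y \<in> I\<rbrakk> \<Longrightarrow> x + y \<in> I"
    and l: "\<And>x s k. \<lbrakk>x \<in> I; s \<in> S; k \<in> carrier K\<rbrakk> \<Longrightarrow> p k s * x \<in> I"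
    and r: "\<And>x s k. \<lbrakk>x \<in> I; s \<in> S; k \<in> carrier K\<rbrakk> \<Longrightarrow> x * p k s \<in> I"
  shows "ideal_of I"
proof -
  have sums: "sum g A \<in> I" if "\<And>i. i \<in> A \<Longrightarrow> g i \<in> I" for A and g :: "'k \<Rightarrow> 'r"
    using that by (induction A rule: infinite_finite_induct) (auto simp: assms)
  have "s * x \<in> I \<and> x * s \<in> I" if x: "x \<in> I" and s: "s \<in> S" for x s
  proof -
    have "(\<Sum>k\<in>supp s. p k s * x) \<in> I" "(\<Sum>k\<in>supp s. x * p k s) \<in> I"
      using x s l r supp_carrier[OF s] by (auto intro!: sums)
    then show ?thesis
      using p_sum[OF s] by (simp add: supp_def sum_distrib_right[symmetric] sum_distrib_left[symmetric])
  qed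
  then show ?thesis using assms by (auto simp: ideal_of_def)
qed

text \<open>Graded simplicity in elementwise form: the non-zero values \<open>p k x\<close> are
  exactly the non-zero homogeneous elements, and \<open>f \<in> I\<close> means
  \<open>I = S\<close>.\<close>

definition homogeneous_simple :: bool
  where "homogeneous_simple \<longleftrightarrow>
    (\<forall>I x k. ideal_of I \<and> x \<in> S \<and> p k x \<noteq> 0 \<and> p k x \<in> I \<longrightarrow> f \<in> I)"

text \<open>
  The set \<open>T\<close> below is the ideal of those \<open>t\<close> whose component in each degree \<open>d\<close> is the degree \<open>d\<close>
  component of some element of \<open>I\<close> supported in the translate \<open>d c\<^sup>-\<^sup>1 (supp x)\<close>. It contains the
  component of \<open>x\<close> in degree \<open>c\<close>, hence \<open>f\<close>. Closure under multiplication from the right uses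
  that \<open>c\<^sup>-\<^sup>1 (supp x)\<close> is central.
\<close>

lemma normalize_support:
  assumes hs: homogeneous_simple and I: "ideal_of I" and x: "x \<in> I" and c: "c \<in> supp x"
    and cen: "supp x \<subseteq> c <# center K"
  obtains y where "y \<in> I" "p \<one> y = f" "supp y \<subseteq> inv c <# supp x"
proof -
  have xS: "x \<in> S" using I x by (rule ideal_ofD)
  have cK: "c \<in> carrier K" using c supp_carrier xS by blast
  define D where "D = inv c <# supp x"
  \<comment> \<open>Translation by \<open>inv c\<close> moves the support from the coset of
    \<open>c\<close> into the center itself.\<close>
  have D: "D \<subseteq> center K"
    using cen cK by (force simp: D_def l_coset_def center_def m_assoc[symmetric])
  have DK: "D \<subseteq> carrier K" using D by (auto simp: center_def)
  define T where "T = {t \<in> S. \<forall>d\<in>carrier K. \<exists>z\<in>I. p d z = p d t \<and> supp z \<subseteq> d <# D}"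
  have "ideal_of T"
  proof (rule ideal_ofI_homogeneous)
    show "T \<subseteq> S" by (auto simp: T_def)
    show "0 \<in> T"
      using ideal_ofD(2)[OF I] by (auto simp: T_def S_zero supp_def p_zero intro!: bexI[of _ 0])
  next
    fix s t assume st: "s \<in> T" "t \<in> T"
    show "s + t \<in> T" unfolding T_def
    proof (intro CollectI conjI ballI)
      show "s + t \<in> S" using st S_add by (auto simp: T_def)
      fix d assume d: "d \<in> carrier K"
      obtain z where z: "z \<in> I" "p d z = p d s" "supp z \<subseteq> d <# D" using st d by (auto simp: T_def)
      obtain w where w: "w \<in> I" "p d w = p d t" "supp w \<subseteq> d <# D" using st d by (auto simp: T_def)
      have S: "z \<in> S" "w \<in> S" "s \<in> S" "t \<in> S" using z w I ideal_ofD(1) st by (auto simp: T_def)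
      have "supp (z + w) \<subseteq> supp z \<union> supp w" using S by (auto simp: supp_def p_add)
      then show "\<exists>z\<in>I. p d z = p d (s + t) \<and> supp z \<subseteq> d <# D"
        using z w S by (intro bexI[of _ "z + w"] ideal_ofD(3)[OF I]) (auto simp: p_add)
    qed
  next
    fix t a k assume t: "t \<in> T" and a: "a \<in> S" and k: "k \<in> carrier K"
    have tS: "t \<in> S" using t by (simp add: T_def)
    show "p k a * t \<in> T" unfolding T_def
    proof (intro CollectI conjI ballI)
      show "p k a * t \<in> S" using a t p_closed S_mult by (auto simp: T_def)
      fix d assume d: "d \<in> carrier K"
      then have dd: "inv k \<otimes> d \<in> carrier K" using k by simp
      obtain z where z: "z \<in> I" "p (inv k \<otimes> d) z = p (inv k \<otimes> d) t" "supp z \<subseteq> (inv k \<otimes> d) <# D"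
        using t dd by (auto simp: T_def)
      have zS: "z \<in> S" using I z by (blast dest: ideal_ofD(1))
      have "supp (p k a * z) \<subseteq> supp (p k a) <#> supp z" using a zS p_closed supp_mult by blast
      also have "\<dots> \<subseteq> d <# D"
      proof
        fix m assume "m \<in> supp (p k a) <#> supp z"
        then obtain n where n: "m = k \<otimes> n" "n \<in> supp z"
          using supp_p[OF a, of k] by (auto simp: set_mult_def)
        then obtain h where h: "h \<in> D" "n = (inv k \<otimes> d) \<otimes> h" using z(3) by (auto simp: l_coset_def)
        then have "m = d \<otimes> h" using n k d DK by (simp add: m_assoc[symmetric] subset_eq)
        then show "m \<in> d <# D" using h by (auto simp: l_coset_def)
      qed
      finally show "\<exists>w\<in>I. p d w = p d (p k a * t) \<and> supp w \<subseteq> d <# D"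
        using z a d k zS tS p_closed
        by (intro bexI[of _ "p k a * z"] ideal_ofD(4)[OF I]) (auto simp: p_homogeneous_mult)
    qed
    show "t * p k a \<in> T" unfolding T_def
    proof (intro CollectI conjI ballI)
      show "t * p k a \<in> S" using a t p_closed S_mult by (auto simp: T_def)
      fix d assume d: "d \<in> carrier K"
      then have dd: "d \<otimes> inv k \<in> carrier K" using k by simp
      obtain z where z: "z \<in> I" "p (d \<otimes> inv k) z = p (d \<otimes> inv k) t" "supp z \<subseteq> (d \<otimes> inv k) <# D"
        using t dd by (auto simp: T_def)
      have zS: "z \<in> S" using I z by (blast dest: ideal_ofD(1))
      have "supp (z * p k a) \<subseteq> supp z <#> supp (p k a)" using a zS p_closed supp_mult by blast
      also have "\<dots> \<subseteq> d <# D"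
      proof
        fix m assume "m \<in> supp z <#> supp (p k a)"
        then obtain n where n: "m = n \<otimes> k" "n \<in> supp z"
          using supp_p[OF a, of k] by (auto simp: set_mult_def)
        then obtain h where h: "h \<in> D" "n = (d \<otimes> inv k) \<otimes> h" using z(3) by (auto simp: l_coset_def)
        have hK: "h \<in> carrier K" "h \<otimes> k = k \<otimes> h" using h D k by (auto simp: center_def)
        have "m = (d \<otimes> inv k) \<otimes> (h \<otimes> k)" using n h k d hK by (simp add: m_assoc)
        also have "\<dots> = d \<otimes> (inv k \<otimes> (k \<otimes> h))" unfolding hK(2) using hK(1) k d by (simp add: m_assoc)
        also have "\<dots> = d \<otimes> h" using hK(1) k d by (simp add: m_assoc[symmetric])
        finally show "m \<in> d <# D" using h by (auto simp: l_coset_def)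
      qed
      finally show "\<exists>w\<in>I. p d w = p d (t * p k a) \<and> supp w \<subseteq> d <# D"
        using z a d k zS tS p_closed
        by (intro bexI[of _ "z * p k a"] ideal_ofD(5)[OF I]) (auto simp: p_mult_homogeneous)
    qed
  qed
  moreover have "p c x \<in> T" unfolding T_def
  proof (intro CollectI conjI ballI)
    show "p c x \<in> S" using xS by (rule p_closed)
    fix d assume d: "d \<in> carrier K"
    show "\<exists>z\<in>I. p d z = p d (p c x) \<and> supp z \<subseteq> d <# D"
    proof (cases "d = c")
      case True
      \<comment> \<open>In degree \<open>c\<close> the element \<open>x\<close> is its own witness,
        since \<open>c <# D\<close> recovers its support.\<close>
      have "supp x \<subseteq> c <# D"
      proof
        fix k assume k: "k \<in> supp x"
        then have "k = c \<otimes> (inv c \<otimes> k)" using cK supp_carrier[OF xS] by (auto simp: m_assoc[symmetric])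
        then show "k \<in> c <# D" using k by (force simp: D_def l_coset_def)
      qed
      then show ?thesis using True x xS by (auto simp: p_p intro!: bexI[of _ x])
    next
      \<comment> \<open>In any other degree the component of \<open>p c x\<close> vanishes, so the
        witness is 0.\<close>
      case False
      then show ?thesis using ideal_ofD(2)[OF I] xS
        by (auto simp: p_p supp_def p_zero intro!: bexI[of _ 0])
    qed
  qed
  ultimately have "f \<in> T" using hs c xS unfolding homogeneous_simple_def supp_def by blast
  \<comment> \<open>The condition that puts \<open>f\<close> into \<open>T\<close> is read in degree
    one.\<close>
  then obtain z where "z \<in> I" "p \<one> z = p \<one> f" "supp z \<subseteq> \<one> <# D" by (auto simp: T_def)
  moreover have "\<one> <# D = D" using DK by (auto simp: l_coset_def subset_eq)
  ultimately show thesis using that p_unit by (simp add: D_def)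
qed

text \<open>
  A normalized element of minimal support is central, because its commutators with homogeneous
  elements have smaller support.
\<close>

lemma unit_mem_ideal_if_support_in_central_coset:
  assumes hs: homogeneous_simple
    and cen: "\<And>z. \<lbrakk>z \<in> S; z \<noteq> 0; \<And>s. s \<in> S \<Longrightarrow> z * s = s * z\<rbrakk> \<Longrightarrow> \<exists>w\<in>S. z * w = f"
    and I: "ideal_of I" and x: "x \<in> I" "x \<noteq> 0" and l: "l \<in> carrier K" "supp x \<subseteq> l <# center K"
  shows "f \<in> I"
proof -
  \<comment> \<open>The coset is left free: a commutator with an element of degree \<open>d\<close>
    has its support in \<open>d <# center K\<close>, and it must still compete for the
    minimum.\<close>
  define Q where "Q x \<longleftrightarrow> x \<in> I \<and> x \<noteq> 0 \<and> (\<exists>l\<in>carrier K. supp x \<subseteq> l <# center K)" for x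
  have cenK: "center K \<subseteq> carrier K" by (auto simp: center_def)
  have "Q x" using x l by (auto simp: Q_def)
  then obtain u where u: "Q u" and min: "\<And>v. Q v \<Longrightarrow> card (supp u) \<le> card (supp v)"
    using ex_has_least_nat[of Q x "\<lambda>v. card (supp v)"] by blast
  have uS: "u \<in> S" and uI: "u \<in> I" and u0: "u \<noteq> 0" using u I by (auto simp: Q_def ideal_ofD)
  obtain l where l: "l \<in> carrier K" "supp u \<subseteq> l <# center K" using u by (auto simp: Q_def)
  have "supp u \<noteq> {}" using p_sum[OF uS] u0 unfolding supp_def by force
  then obtain c where c: "c \<in> supp u" by blast
  have cK: "c \<in> carrier K" using c supp_carrier uS by blast
  obtain z where z: "z \<in> center K" "c = l \<otimes> z" using c l by (auto simp: l_coset_def)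
  \<comment> \<open>Any degree in the support can represent the coset.\<close>
  have "supp u \<subseteq> c <# center K"
  proof
    fix k assume "k \<in> supp u"
    then obtain w where w: "w \<in> center K" "k = l \<otimes> w" using l by (auto simp: l_coset_def)
    have zw: "inv z \<otimes> w \<in> center K" using z w by (intro mult_mem_center inv_mem_center)
    have "k = c \<otimes> (inv z \<otimes> w)"
      using w z l(1) by (simp add: m_assoc center_carrier mult_inv_cancel)
    then show "k \<in> c <# center K" using zw by (auto simp: l_coset_def)
  qed
  from normalize_support[OF hs I uI c this]
  obtain y where y: "y \<in> I" "p \<one> y = f" "supp y \<subseteq> inv c <# supp u" by blast
  have yS: "y \<in> S" using y I by (blast dest: ideal_ofD(1))
  have y0: "y \<noteq> 0" using y(2) unit_nonzero p_zero by force
  have img: "inv c <# supp u = (\<lambda>k. inv c \<otimes> k) ` supp u" by (auto simp: l_coset_def)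
  have cy: "card (supp y) \<le> card (supp u)"
    using y(3) supp_finite[OF uS] unfolding img by (meson card_image_le card_mono finite_imageI le_trans)
  have ycen: "supp y \<subseteq> center K"
    using y(3) \<open>supp u \<subseteq> c <# center K\<close> cK cenK
    by (force simp: l_coset_def m_assoc[symmetric])
  have comm: "p d s * y = y * p d s" if s: "s \<in> S" and d: "d \<in> carrier K" for s d
  proof (rule ccontr)
    let ?v = "p d s * y - y * p d s"
    assume ne: "p d s * y \<noteq> y * p d s"
    have vI: "?v \<in> I" using I y s by (intro ideal_of_diff ideal_ofD(4,5) p_closed) auto
    \<comment> \<open>In degree \<open>m\<close> the commutator involves \<open>y\<close> only in
      the degrees \<open>inv d \<otimes> m\<close> and \<open>m \<otimes> inv d\<close>. These agree
      as soon as one of them is central. For \<open>m = d\<close> the two terms are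
      \<open>p d s * f\<close> and \<open>f * p d s\<close>, which cancel, so the degree
      \<open>\<one>\<close> of \<open>y\<close> contributes nothing.\<close>
    have vsub: "supp ?v \<subseteq> (\<lambda>k. d \<otimes> k) ` (supp y - {\<one>})"
    proof
      fix m assume m: "m \<in> supp ?v"
      have mK: "m \<in> carrier K" using m vI I supp_carrier by (meson ideal_ofD(1) subsetD)
      have pm: "p m ?v = p d s * p (inv d \<otimes> m) y - p (m \<otimes> inv d) y * p d s"
        using s yS d mK by (simp add: p_diff S_mult p_closed p_homogeneous_mult p_mult_homogeneous)
      have eq: "m \<otimes> inv d = inv d \<otimes> m" if "inv d \<otimes> m \<in> center K \<or> m \<otimes> inv d \<in> center K"
      proof -
        have 1: "d \<otimes> (inv d \<otimes> m) = m" "m \<otimes> inv d \<otimes> d = m"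
          using d mK by (simp_all add: mult_inv_cancel m_assoc)
        show ?thesis using that
        proof
          assume h: "inv d \<otimes> m \<in> center K"
          then have "m = inv d \<otimes> m \<otimes> d" using center_commute[OF h d] 1 by simp
          then have "m \<otimes> inv d = inv d \<otimes> m \<otimes> d \<otimes> inv d" by simp
          then show ?thesis using d mK by (simp add: m_assoc)
        next
          assume h: "m \<otimes> inv d \<in> center K"
          then have "m = d \<otimes> (m \<otimes> inv d)" using center_commute[OF h d] 1 by simp
          then have "inv d \<otimes> m = inv d \<otimes> (d \<otimes> (m \<otimes> inv d))" by simp
          then show ?thesis using d mK by (simp add: inv_mult_cancel)
        qed
      qed
      have nz: "p m ?v \<noteq> 0" using m by (simp add: supp_def)
      then have "inv d \<otimes> m \<in> supp y \<or> m \<otimes> inv d \<in> supp y" unfolding pm supp_def by force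
      then have e: "m \<otimes> inv d = inv d \<otimes> m" and sy: "inv d \<otimes> m \<in> supp y" using eq ycen by force+
      have "inv d \<otimes> m \<noteq> \<one>"
      proof
        assume "inv d \<otimes> m = \<one>"
        then have "p m ?v = 0" unfolding pm e using y(2) s by (simp add: p_closed unit_left unit_right)
        then show False using nz by simp
      qed
      moreover have "m = d \<otimes> (inv d \<otimes> m)" using d mK by (simp add: m_assoc[symmetric])
      ultimately show "m \<in> (\<lambda>k. d \<otimes> k) ` (supp y - {\<one>})" using sy by blast
    qed
    have "supp ?v \<subseteq> d <# center K" using vsub ycen by (force simp: l_coset_def)
    then have "Q ?v" using vI ne d by (auto simp: Q_def)
    then have "card (supp u) \<le> card (supp ?v)" by (rule min)
    also have "\<dots> \<le> card (supp y - {\<one>})"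
      using vsub supp_finite[OF yS] by (meson card_image_le card_mono finite_Diff finite_imageI le_trans)
    also have "\<dots> < card (supp y)"
      using y(2) unit_nonzero supp_finite[OF yS] by (intro card_Diff1_less) (auto simp: supp_def)
    finally show False using cy by simp
  qed
  have "y * s = s * y" if s: "s \<in> S" for s
  proof -
    have "y * s = (\<Sum>k\<in>supp s. y * p k s)" "s * y = (\<Sum>k\<in>supp s. p k s * y)"
      using p_sum[OF s] by (simp_all add: supp_def sum_distrib_left[symmetric] sum_distrib_right[symmetric])
    moreover have "(\<Sum>k\<in>supp s. y * p k s) = (\<Sum>k\<in>supp s. p k s * y)"
      using comm[OF s] supp_carrier[OF s] by (intro sum.cong refl) auto
    ultimately show ?thesis by simp
  qed
  \<comment> \<open>The central element \<open>y\<close> is a unit, so the ideal contains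
    \<open>y * w = f\<close>.\<close>
  then obtain w where "w \<in> S" "y * w = f" using cen[OF yS y0] by blast
  then show "f \<in> I" using ideal_ofD(5)[OF I y(1)] by force
qed

end

section \<open>Coarsening the grading and hypercentral groups\<close>

context group_graded_corner
begin

text \<open>Cutting \<open>A\<close> down to the support keeps the sum finite for
  \<open>x \<in> S\<close>, also when \<open>A\<close> is an infinite coset.\<close>

definition proj :: "'k set \<Rightarrow> 'r \<Rightarrow> 'r"
  where "proj A x = (\<Sum>k\<in>supp x \<inter> A. p k x)"

lemma proj_closed: "x \<in> S \<Longrightarrow> proj A x \<in> S"
  by (auto simp: proj_def intro!: S_sum p_closed)

lemma p_proj:
  assumes x: "x \<in> S"
  shows "p k (proj A x) = (if k \<in> A then p k x else 0)"
proof -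
  have "p k (proj A x) = (\<Sum>l\<in>supp x \<inter> A. p k (p l x))"
    unfolding proj_def by (rule p_of_sum) (simp add: x p_closed)
  also have "\<dots> = (\<Sum>l\<in>supp x \<inter> A. if k = l then p l x else 0)"
    by (simp add: p_p x)
  also have "\<dots> = (if k \<in> A then p k x else 0)"
    using supp_finite[OF x] by (auto simp: supp_def)
  finally show ?thesis .
qed

lemma supp_proj: "x \<in> S \<Longrightarrow> supp (proj A x) = supp x \<inter> A"
  by (auto simp: supp_def p_proj split: if_splits)

lemma supp_zero: "supp 0 = {}"
  by (simp add: supp_def p_zero)

lemma supp_empty: "\<lbrakk>x \<in> S; supp x = {}\<rbrakk> \<Longrightarrow> x = 0"
  using p_eqI[of x 0] by (auto simp: supp_def p_zero S_zero)

lemma proj_eq_0_iff: "x \<in> S \<Longrightarrow> proj A x = 0 \<longleftrightarrow> supp x \<inter> A = {}"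
  using supp_proj[of x A] supp_empty[OF proj_closed[of x A]] by (auto simp: supp_zero)

lemma proj_id: "\<lbrakk>x \<in> S; supp x \<subseteq> A\<rbrakk> \<Longrightarrow> proj A x = x"
  by (rule p_eqI) (auto simp: proj_closed p_proj supp_def)

text \<open>The cosets of \<open>N\<close> partition the degrees, so collecting components over each
  coset gives a grading by the quotient. The value 0 off the cosets ensures that non-zero components
  occur only in degrees from the quotient.\<close>

lemma coarsen:
  assumes N: "N \<lhd> K"
  shows "group_graded_corner (K Mod N) S f (\<lambda>C x. if C \<in> rcosets N then proj C x else 0)"
    (is "group_graded_corner _ _ _ ?q")
proof -
  interpret N: normal N K by (rule N)
  interpret Q: group "K Mod N" by (rule N.factorgroup_is_group)
  have NK: "N \<subseteq> carrier K" by (rule N.subset)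
  have coset_unique: "C = N #> k" if "C \<in> rcosets N" "k \<in> C" for C k
    using that repr_independence[OF _ _ N.is_subgroup] by (auto simp: RCOSETS_def)
  have coset: "N #> k \<in> rcosets N" "k \<in> N #> k" if "k \<in> carrier K" for k
    using that NK by (auto intro: rcosetsI rcos_self N.is_subgroup)
  have coset_iff: "k \<in> C \<longleftrightarrow> C = N #> k" if "C \<in> rcosets N" "k \<in> carrier K" for C k
    using coset_unique coset that by blast
  have fin: "{C. ?q C x \<noteq> 0} \<subseteq> (\<lambda>k. N #> k) ` supp x" if "x \<in> S" for x
    using that coset_unique by (force simp: proj_eq_0_iff split: if_splits)
  show ?thesis
  proof unfold_locales
    fix x y assume xy: "x \<in> S" "y \<in> S"
    show "x + y \<in> S" "- x \<in> S" "x * y \<in> S" "f * x = x" "x * f = x"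
      using xy by (auto simp: S_add S_uminus S_mult unit_left unit_right)
    fix C D
    show "?q C x \<in> S" using xy by (simp add: proj_closed S_zero)
    show "?q C (x + y) = ?q C x + ?q C y"
    proof (cases "C \<in> rcosets N")
      case True
      have "proj C (x + y) = proj C x + proj C y"
        by (rule p_eqI) (use xy in \<open>auto simp: proj_closed S_add p_proj p_add\<close>)
      then show ?thesis using True by simp
    qed simp
    show fin_x: "finite {C. ?q C x \<noteq> 0}"
      using fin[OF xy(1)] supp_finite[OF xy(1)] by (meson finite_imageI finite_subset)
    show "?q C x \<noteq> 0 \<Longrightarrow> C \<in> carrier (K Mod N)" by (auto simp: FactGroup_def split: if_splits)
    show "(\<Sum>C | ?q C x \<noteq> 0. ?q C x) = x"
    proof (rule p_eqI)
      show "(\<Sum>C | ?q C x \<noteq> 0. ?q C x) \<in> S"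
        using xy by (intro S_sum) (auto simp: proj_closed S_zero)
      show "x \<in> S" by (rule xy)
      fix k assume k: "k \<in> carrier K"
      have "p k (\<Sum>C | ?q C x \<noteq> 0. ?q C x) = (\<Sum>C | ?q C x \<noteq> 0. p k (?q C x))"
        using xy by (intro p_of_sum) (auto simp: proj_closed S_zero)
      \<comment> \<open>Exactly one coset contains \<open>k\<close>, so at most one summand
        survives.\<close>
      also have "\<dots> = (\<Sum>C | ?q C x \<noteq> 0. if C = N #> k then p k x else 0)"
        using xy k coset_iff by (intro sum.cong refl) (auto simp: p_proj p_zero coset)
      also have "\<dots> = p k x"
        using fin_x xy coset[OF k] by (auto simp: proj_eq_0_iff supp_def)
      finally show "p k (\<Sum>C | ?q C x \<noteq> 0. ?q C x) = p k x" .
    qed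
    show "?q C (?q D x) = (if C = D then ?q D x else 0)"
    proof (cases "C \<in> rcosets N \<and> D \<in> rcosets N")
      case True
      have "proj C (proj D x) = (if C = D then proj D x else 0)"
        by (rule p_eqI[OF proj_closed]) (use xy True coset_iff in \<open>auto simp: proj_closed p_proj S_zero p_zero\<close>)
      then show ?thesis using True by simp
    next
      case False
      then show ?thesis by (auto simp: proj_def supp_def p_zero)
    qed
    assume "C \<in> carrier (K Mod N)" "D \<in> carrier (K Mod N)"
    then have CD: "C \<in> rcosets N" "D \<in> rcosets N" by (simp_all add: FactGroup_def)
    then have CDr: "C <#> D \<in> rcosets N" using N.setmult_closed by blast
    \<comment> \<open>The support of the product lies in the product coset, and there
      \<open>proj\<close> acts as the identity.\<close>
    have "supp (proj C x * proj D y) \<subseteq> supp (proj C x) <#> supp (proj D y)"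
      using xy by (intro supp_mult proj_closed)
    also have "\<dots> \<subseteq> C <#> D" using xy by (auto simp: supp_proj set_mult_def)
    finally have "proj (C <#> D) (proj C x * proj D y) = proj C x * proj D y"
      using xy by (intro proj_id S_mult proj_closed)
    then show "?q (C \<otimes>\<^bsub>K Mod N\<^esub> D) (?q C x * ?q D y) = ?q C x * ?q D y"
      using CD CDr by (simp add: FactGroup_def)
  next
    have "supp f \<subseteq> N"
      using supp_p[OF S_unit, of \<one>] N.one_closed unfolding p_unit by blast
    moreover have "N \<in> rcosets N" using coset(1)[of \<one>] coset_mult_one[OF NK] by simp
    ultimately show "?q \<one>\<^bsub>K Mod N\<^esub> f = f"
      using S_unit by (simp add: FactGroup_def proj_id)
  qed (auto simp: S_zero S_unit unit_nonzero)
qed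

text \<open>Homogeneous simplicity for the grading by \<open>K Mod N\<close>. It interpolates
  between homogeneous simplicity, for \<open>N = {\<one>}\<close>, and simplicity of
  \<open>S\<close>, for \<open>N = carrier K\<close>.\<close>

definition coset_simple :: "'k set \<Rightarrow> bool"
  where "coset_simple N \<longleftrightarrow>
    (\<forall>I x. ideal_of I \<and> x \<in> I \<and> x \<noteq> 0 \<and> (\<exists>k\<in>carrier K. supp x \<subseteq> N #> k) \<longrightarrow> f \<in> I)"

text \<open>The central coset argument is applied to the grading by the quotient: a support inside a
  coset of the preimage of the center becomes a coarse support inside a coset of the center.\<close>

lemma coset_simple_center_preimage:
  assumes N: "N \<lhd> K" and simple: "coset_simple N"
    and cen: "\<And>z. \<lbrakk>z \<in> S; z \<noteq> 0; \<And>s. s \<in> S \<Longrightarrow> z * s = s * z\<rbrakk> \<Longrightarrow> \<exists>w\<in>S. z * w = f"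
  shows "coset_simple {k \<in> carrier K. N #> k \<in> center (K Mod N)}" (is "coset_simple ?M")
  unfolding coset_simple_def
proof (intro allI impI, elim conjE bexE)
  fix I x k assume I: "ideal_of I" and x: "x \<in> I" "x \<noteq> 0" and k: "k \<in> carrier K" "supp x \<subseteq> ?M #> k"
  interpret N: normal N K by (rule N)
  define q where "q C x = (if C \<in> rcosets N then proj C x else 0)" for C x
  interpret Q: group_graded_corner "K Mod N" S f q
    using coarsen[OF N] unfolding q_def .
  have xS: "x \<in> S" using I x(1) by (rule ideal_ofD)
  have hs: Q.homogeneous_simple
    unfolding Q.homogeneous_simple_def
  proof (intro allI impI, elim conjE)
    fix J y C assume J: "ideal_of J" "y \<in> S" "q C y \<noteq> 0" "q C y \<in> J"
    then have C: "C \<in> rcosets N" "q C y = proj C y" by (auto simp: q_def split: if_splits)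
    then obtain k where "k \<in> carrier K" "C = N #> k" by (auto simp: RCOSETS_def)
    then have "\<exists>k\<in>carrier K. supp (q C y) \<subseteq> N #> k" using C J by (auto simp: supp_proj)
    then show "f \<in> J" using simple J unfolding coset_simple_def by blast
  qed
  have "Q.supp x \<subseteq> (N #> k) <#\<^bsub>K Mod N\<^esub> center (K Mod N)"
  proof
    fix C assume "C \<in> Q.supp x"
    then have C: "C \<in> rcosets N" "supp x \<inter> C \<noteq> {}"
      using xS by (auto simp: Q.supp_def q_def proj_eq_0_iff split: if_splits)
    then obtain m where m: "m \<in> supp x" "m \<in> C" by blast
    then obtain n where n: "n \<in> ?M" "m = n \<otimes> k" using k by (auto simp: r_coset_def)
    have "C = N #> m"
      using C m N.subset N.is_subgroup repr_independence by (auto simp: RCOSETS_def)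
    also have "\<dots> = (N #> n) \<otimes>\<^bsub>K Mod N\<^esub> (N #> k)"
      using n k by (simp add: FactGroup_def N.rcos_sum)
    \<comment> \<open>The coset of \<open>n\<close> is central, so the right coset turns into a left
      one.\<close>
    also have "\<dots> = (N #> k) \<otimes>\<^bsub>K Mod N\<^esub> (N #> n)"
      using n k by (intro Q.center_commute) (auto simp: FactGroup_def intro: rcosetsI N.subset)
    finally show "C \<in> (N #> k) <#\<^bsub>K Mod N\<^esub> center (K Mod N)"
      using n by (auto simp: l_coset_def)
  qed
  moreover have "N #> k \<in> carrier (K Mod N)" using k by (simp add: FactGroup_def rcosetsI N.subset)
  ultimately show "f \<in> I"
    using Q.unit_mem_ideal_if_support_in_central_coset[OF hs cen I x] by blast
qed

text \<open>Modulo \<open>N\<close>, conjugation fixes central elements, so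
  \<open>x \<otimes> m \<otimes> inv x\<close> lies in the same coset of \<open>N\<close> as
  \<open>m\<close>.\<close>

lemma normal_center_preimage:
  assumes N: "N \<lhd> K"
  shows "{k \<in> carrier K. N #> k \<in> center (K Mod N)} \<lhd> K" (is "?M \<lhd> K")
proof -
  interpret N: normal N K by (rule N)
  interpret Q: group "K Mod N" by (rule N.factorgroup_is_group)
  interpret h: group_hom K "K Mod N" "\<lambda>k. N #> k"
    by unfold_locales (rule N.r_coset_hom_Mod)
  show ?thesis
  proof (rule normal_invI)
    show "subgroup ?M K"
    proof
      show "?M \<subseteq> carrier K" by blast
      show "\<one> \<in> ?M" using Q.one_mem_center h.hom_one by simp
      show "x \<otimes> y \<in> ?M" if "x \<in> ?M" "y \<in> ?M" for x y
        using that Q.mult_mem_center h.hom_mult by simp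
      show "inv x \<in> ?M" if "x \<in> ?M" for x
        using that Q.inv_mem_center h.hom_inv by simp
    qed
  next
    fix x m assume x: "x \<in> carrier K" and m: "m \<in> ?M"
    have "N #> (x \<otimes> m \<otimes> inv x) = (N #> x) \<otimes>\<^bsub>K Mod N\<^esub> (N #> m) \<otimes>\<^bsub>K Mod N\<^esub> inv\<^bsub>K Mod N\<^esub> (N #> x)"
      using x m h.hom_mult h.hom_inv by (simp)
    also have "\<dots> = (N #> m) \<otimes>\<^bsub>K Mod N\<^esub> (N #> x) \<otimes>\<^bsub>K Mod N\<^esub> inv\<^bsub>K Mod N\<^esub> (N #> x)"
      using x m Q.center_commute[of "N #> m" "N #> x"] h.hom_closed by simp
    also have "\<dots> = N #> m"
      using x m Q.inv_solve_right'[of "N #> m" "(N #> m) \<otimes>\<^bsub>K Mod N\<^esub> (N #> x)" "N #> x"]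
        h.hom_closed Q.m_closed by blast
    finally show "x \<otimes> m \<otimes> inv x \<in> ?M" using x m by simp
  qed
qed

text \<open>This is simplicity of the ring \<open>S\<close>, since an ideal containing
  \<open>f\<close> is all of \<open>S\<close>. It amounts to \<open>coset_simple\<close> for the
  whole group, which is reached from the trivial subgroup.\<close>

lemma unit_mem_nonzero_ideal:
  assumes hyper: "hypercentral_group K" and hs: homogeneous_simple
    and cen: "\<And>z. \<lbrakk>z \<in> S; z \<noteq> 0; \<And>s. s \<in> S \<Longrightarrow> z * s = s * z\<rbrakk> \<Longrightarrow> \<exists>w\<in>S. z * w = f"
    and I: "ideal_of I" "x \<in> I" "x \<noteq> 0"
  shows "f \<in> I"
proof -
  define \<A> where "\<A> = {N. N \<lhd> K \<and> coset_simple N}"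
  \<comment> \<open>A non-zero element supported in a coset of the trivial subgroup is
    homogeneous.\<close>
  have "coset_simple {\<one>}" unfolding coset_simple_def
  proof (intro allI impI, elim conjE bexE)
    fix I x k assume I: "ideal_of I" "x \<in> I" "x \<noteq> 0" and k: "k \<in> carrier K" "supp x \<subseteq> {\<one>} #> k"
    have xS: "x \<in> S" using I ideal_ofD(1) by blast
    have "supp x \<subseteq> {k}" using k by (simp add: r_coset_def)
    have "p k x = x" by (rule p_eqI[OF p_closed[OF xS] xS]) (use xS \<open>supp x \<subseteq> {k}\<close> in \<open>auto simp: p_p supp_def\<close>)
    then show "f \<in> I" using hs I xS unfolding homogeneous_simple_def by metis
  qed
  then have "{\<one>} \<in> \<A>" by (simp add: \<A>_def one_is_normal)
  moreover have "\<Union>\<C> \<in> \<A>" if ne: "\<C> \<noteq> {}" and chain: "subset.chain \<A> \<C>" for \<C>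
  proof -
    have sub: "N \<lhd> K" "coset_simple N" if "N \<in> \<C>" for N
      using that chain by (auto simp: subset.chain_def \<A>_def)
    have comp: "X \<subseteq> Y \<or> Y \<subseteq> X" if "X \<in> \<C>" "Y \<in> \<C>" for X Y
      using that chain unfolding subset.chain_def by blast
    have sg: "subgroup N K" if "N \<in> \<C>" for N using sub(1)[OF that] by (rule normal_imp_subgroup)
    have "\<Union>\<C> \<lhd> K"
    proof (rule normal_invI)
      show "subgroup (\<Union>\<C>) K"
      proof
        show "\<Union>\<C> \<subseteq> carrier K" using sg by (auto dest: subgroup.mem_carrier)
        show "\<one> \<in> \<Union>\<C>" using ne subgroup.one_closed[OF sg] by blast
        show "x \<otimes> y \<in> \<Union>\<C>" if xy: "x \<in> \<Union>\<C>" "y \<in> \<Union>\<C>" for x y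
        proof -
          obtain X Y where XY: "x \<in> X" "y \<in> Y" "X \<in> \<C>" "Y \<in> \<C>" using xy by blast
          then obtain Z where Z: "x \<in> Z" "y \<in> Z" "Z \<in> \<C>" using comp by blast
          then show ?thesis using subgroup.m_closed[OF sg[OF Z(3)] Z(1,2)] by blast
        qed
        show "inv x \<in> \<Union>\<C>" if x: "x \<in> \<Union>\<C>" for x
        proof -
          obtain X where X: "x \<in> X" "X \<in> \<C>" using x by blast
          then show ?thesis using subgroup.m_inv_closed[OF sg[OF X(2)] X(1)] by blast
        qed
      qed
      fix x h assume x: "x \<in> carrier K" and "h \<in> \<Union>\<C>"
      then obtain X where X: "h \<in> X" "X \<in> \<C>" by blast
      then show "x \<otimes> h \<otimes> inv x \<in> \<Union>\<C>"
        using normal.inv_op_closed2[OF sub(1)[OF X(2)] x X(1)] by blast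
    qed
    moreover have "coset_simple (\<Union>\<C>)" unfolding coset_simple_def
    proof (intro allI impI, elim conjE bexE)
      fix I x k
      assume I: "ideal_of I" "x \<in> I" "x \<noteq> 0" and k: "k \<in> carrier K" "supp x \<subseteq> \<Union>\<C> #> k"
      have xS: "x \<in> S" using I ideal_ofD(1) by blast
      \<comment> \<open>A finite set of degrees in a translate of the union lies in the translate of
        a single member of the chain.\<close>
      have "\<exists>N\<in>\<C>. F \<subseteq> N #> k" if "finite F" "F \<subseteq> \<Union>\<C> #> k" for F
        using that
      proof (induction F)
        case empty
        then show ?case using ne by blast
      next
        case (insert a F)
        then obtain N where N: "N \<in> \<C>" "F \<subseteq> N #> k" by blast
        obtain N' where N': "N' \<in> \<C>" "a \<in> N' #> k" using insert.prems by (auto simp: r_coset_def)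
        show ?case using comp[OF N(1) N'(1)] N N' by (auto simp: r_coset_def) blast+
      qed
      then obtain N where "N \<in> \<C>" "supp x \<subseteq> N #> k" using supp_finite[OF xS] k by blast
      then show "f \<in> I" using sub(2) I k(1) unfolding coset_simple_def by blast
    qed
    ultimately show ?thesis by (simp add: \<A>_def)
  qed
  ultimately obtain N where NA: "N \<in> \<A>" and max: "\<And>X. \<lbrakk>X \<in> \<A>; N \<subseteq> X\<rbrakk> \<Longrightarrow> X = N"
    using subset_Zorn_nonempty[of \<A>] by blast
  have N: "N \<lhd> K" "coset_simple N" using NA by (auto simp: \<A>_def)
  interpret N: normal N K by (rule N)
  interpret Q: group "K Mod N" by (rule N.factorgroup_is_group)
  have coset_N: "N #> k = N \<longleftrightarrow> k \<in> N" if "k \<in> carrier K" for k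
    using that N.is_subgroup coset_join1 N.subset N.rcos_const[of k] is_group by blast
  define M where "M = {k \<in> carrier K. N #> k \<in> center (K Mod N)}"
  \<comment> \<open>The preimage of the center belongs to the family too, so maximality forces
    \<open>M = N\<close>; this says that the quotient has trivial center.\<close>
  have "M \<in> \<A>"
    using normal_center_preimage[OF N(1)] coset_simple_center_preimage[OF N cen]
    by (simp add: \<A>_def M_def)
  moreover have "N \<subseteq> M"
  proof
    fix k assume "k \<in> N"
    then have "k \<in> carrier K" "N #> k = \<one>\<^bsub>K Mod N\<^esub>"
      using coset_N N.subset by (auto simp: FactGroup_def)
    then show "k \<in> M" using Q.one_mem_center by (simp only: M_def mem_Collect_eq)
  qed
  ultimately have "M = N" by (rule max)
  have "center (K Mod N) = {\<one>\<^bsub>K Mod N\<^esub>}"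
  proof
    show "{\<one>\<^bsub>K Mod N\<^esub>} \<subseteq> center (K Mod N)" using Q.one_mem_center by simp
    show "center (K Mod N) \<subseteq> {\<one>\<^bsub>K Mod N\<^esub>}"
    proof
      fix C assume C: "C \<in> center (K Mod N)"
      then obtain k where k: "k \<in> carrier K" "C = N #> k"
        using Q.center_carrier by (force simp: FactGroup_def RCOSETS_def)
      then have "k \<in> N" using C \<open>M = N\<close> by (auto simp: M_def)
      then show "C \<in> {\<one>\<^bsub>K Mod N\<^esub>}" using k coset_N by (simp add: FactGroup_def)
    qed
  qed
  \<comment> \<open>Hypercentrality excludes a non-trivial quotient with trivial center.\<close>
  then have "trivial_group (K Mod N)" using hyper N(1) unfolding hypercentral_group_def by blast
  then have "carrier (K Mod N) = {N}" by (simp add: trivial_group_def FactGroup_def)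
  then have "carrier K \<subseteq> N" using coset_N rcosetsI[OF N.subset] by (auto simp: FactGroup_def)
  then have "supp x \<subseteq> N #> \<one>"
    using I supp_carrier[of x] ideal_ofD(1) N.subset by (simp add: coset_mult_one)
  then show "f \<in> I" using N(2) I unfolding coset_simple_def by blast
qed

end

section \<open>Rings graded by a semigroup\<close>

locale graded_ring =
  fixes R :: "'g::semigroup_mult \<Rightarrow> 'r::ring set"
  assumes grading: "grading R"
begin

text \<open>Summation is a bijection from the finitely supported families onto the ring, so its
  inverse yields the coordinates of \<open>x\<close>.\<close>

definition component :: "'g \<Rightarrow> 'r \<Rightarrow> 'r"
  where "component g x = inv_into (finsupp_families R UNIV) Sum_any x g"

lemma R_zero: "0 \<in> R g"
  and R_add: "\<lbrakk>x \<in> R g; y \<in> R g\<rbrakk> \<Longrightarrow> x + y \<in> R g"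
  and R_uminus: "x \<in> R g \<Longrightarrow> - x \<in> R g"
  and R_mult: "\<lbrakk>x \<in> R g; y \<in> R h\<rbrakk> \<Longrightarrow> x * y \<in> R (g * h)"
  using grading by (auto simp: grading_def internal_direct_sum_def add_subgroup_def)

lemma bij_Sum_any: "bij_betw Sum_any (finsupp_families R UNIV) UNIV"
  using grading by (simp add: grading_def internal_direct_sum_def)

lemma comp_family: "(\<lambda>g. component g x) \<in> finsupp_families R UNIV"
  unfolding component_def using bij_Sum_any by (auto simp: bij_betw_def intro: inv_into_into)

lemma Sum_any_comp: "Sum_any (\<lambda>g. component g x) = x"
  unfolding component_def using bij_Sum_any f_inv_into_f[of x Sum_any "finsupp_families R UNIV"]
  by (auto simp: bij_betw_def)

lemma comp_Sum_any:
  assumes "finite {g. c g \<noteq> 0}" "\<And>g. c g \<in> R g"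
  shows "component g (Sum_any c) = c g"
proof -
  have "c \<in> finsupp_families R UNIV" using assms by (simp add: finsupp_families_def)
  then show ?thesis
    unfolding component_def using bij_Sum_any by (simp add: bij_betw_def inv_into_f_f)
qed

lemma comp_mem: "component g x \<in> R g"
  and comp_finite: "finite {g. component g x \<noteq> 0}"
  using comp_family[of x] by (auto simp: finsupp_families_def)

lemma sum_comp: "(\<Sum>g | component g x \<noteq> 0. component g x) = x"
  using Sum_any_comp[of x] by (simp add: Sum_any.expand_set)

lemma comp_homogeneous:
  assumes "x \<in> R h"
  shows "component g x = (if g = h then x else 0)"
proof -
  let ?c = "\<lambda>g. if g = h then x else 0"
  have fin: "{g. ?c g \<noteq> 0} \<subseteq> {h}" by auto
  then have "Sum_any ?c = x" by (simp add: Sum_any.expand_superset[of "{h}"])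
  moreover have "component g (Sum_any ?c) = ?c g"
    using assms finite_subset[OF fin] by (intro comp_Sum_any) (auto simp: R_zero)
  ultimately show ?thesis by simp
qed

lemma comp_zero: "component g 0 = 0"
  using comp_homogeneous[OF R_zero, of g] by simp

lemma comp_add: "component g (x + y) = component g x + component g y"
proof -
  let ?c = "\<lambda>g. component g x + component g y"
  have "Sum_any ?c = x + y"
    using Sum_any.distrib[OF comp_finite comp_finite, of x y] by (simp add: Sum_any_comp)
  moreover have "{g. ?c g \<noteq> 0} \<subseteq> {g. component g x \<noteq> 0} \<union> {g. component g y \<noteq> 0}" by auto
  then have "finite {g. ?c g \<noteq> 0}" using comp_finite by (meson finite_UnI finite_subset)
  then have "component g (Sum_any ?c) = ?c g" by (intro comp_Sum_any) (auto simp: R_add comp_mem)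
  ultimately show ?thesis by simp
qed

text \<open>Every element is a finite sum of homogeneous ones. Identities that are additive in a
  variable are reduced to homogeneous values of it in this way.\<close>

lemma homogeneous_induct [case_names zero add homogeneous]:
  assumes "P 0" "\<And>x y. \<lbrakk>P x; P y\<rbrakk> \<Longrightarrow> P (x + y)" "\<And>g x. x \<in> R g \<Longrightarrow> P x"
  shows "P x"
proof -
  have "P (\<Sum>g\<in>A. component g x)" for A
    by (induction A rule: infinite_finite_induct) (auto intro: assms comp_mem)
  then have "P (\<Sum>g | component g x \<noteq> 0. component g x)" .
  then show ?thesis unfolding sum_comp .
qed

text \<open>Uniqueness of the decomposition is inherited from the grading of the whole ring; closure
  under components gives existence inside \<open>I\<close>.\<close>

lemma graded_idealI:
  assumes I: "two_sided_ideal I" and component: "\<And>g x. x \<in> I \<Longrightarrow> component g x \<in> I"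
  shows "graded_ideal R I"
proof -
  have sub: "finsupp_families (\<lambda>g. I \<inter> R g) UNIV \<subseteq> finsupp_families R UNIV"
    by (auto simp: finsupp_families_def)
  have I_sum: "sum c A \<in> I" if "\<And>g. c g \<in> I" for c A
    using that I
    by (induction A rule: infinite_finite_induct) (auto simp: two_sided_ideal_def add_subgroup_def)
  have "Sum_any ` finsupp_families (\<lambda>g. I \<inter> R g) UNIV = I"
  proof
    show "Sum_any ` finsupp_families (\<lambda>g. I \<inter> R g) UNIV \<subseteq> I"
      by (auto simp: finsupp_families_def Sum_any.expand_set intro!: I_sum)
    show "I \<subseteq> Sum_any ` finsupp_families (\<lambda>g. I \<inter> R g) UNIV"
    proof
      fix x assume "x \<in> I"
      then have "(\<lambda>g. component g x) \<in> finsupp_families (\<lambda>g. I \<inter> R g) UNIV"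
        using component by (auto simp: finsupp_families_def comp_mem comp_finite)
      then show "x \<in> Sum_any ` finsupp_families (\<lambda>g. I \<inter> R g) UNIV"
        using Sum_any_comp[of x] by (metis imageI)
    qed
  qed
  then have "bij_betw Sum_any (finsupp_families (\<lambda>g. I \<inter> R g) UNIV) I"
    using bij_Sum_any inj_on_subset[OF _ sub] by (auto simp: bij_betw_def)
  then show ?thesis
    using I by (auto simp: graded_ideal_def internal_direct_sum_def two_sided_ideal_def
        add_subgroup_def R_zero R_add R_uminus)
qed

text \<open>This is the largest graded ideal inside \<open>J\<close>. Graded simplicity is applied
  to it once \<open>J\<close> is known to contain the homogeneous element \<open>f\<close>.\<close>

lemma graded_ideal_comps:
  assumes J: "two_sided_ideal J"
  shows "graded_ideal R {x. \<forall>g. component g x \<in> J}" (is "graded_ideal R ?L")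
proof (rule graded_idealI)
  have J': "0 \<in> J" "\<And>x y. \<lbrakk>x \<in> J; y \<in> J\<rbrakk> \<Longrightarrow> x + y \<in> J"
      "\<And>r x. x \<in> J \<Longrightarrow> r * x \<in> J" "\<And>r x. x \<in> J \<Longrightarrow> x * r \<in> J"
    using J by (auto simp: two_sided_ideal_def add_subgroup_def)
  have L_sum: "sum c A \<in> ?L" if "\<And>g. g \<in> A \<Longrightarrow> c g \<in> ?L" for c :: "'g \<Rightarrow> 'r" and A
    using that by (induction A rule: infinite_finite_induct) (auto simp: comp_zero comp_add J')
  have left: "r * x \<in> ?L" if x: "x \<in> ?L" for r x
  proof (induction r rule: homogeneous_induct)
    case (homogeneous a r)
    \<comment> \<open>Different \<open>g\<close> may lead to the same degree \<open>a * g\<close>,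
      so the summands are treated one at a time: each is homogeneous and lies in
      \<open>J\<close>.\<close>
    have "(\<Sum>g | component g x \<noteq> 0. r * component g x) \<in> ?L"
      using x J' comp_homogeneous[OF R_mult[OF homogeneous comp_mem]] by (intro L_sum) simp
    then show ?case by (simp add: sum_distrib_left[symmetric] sum_comp)
  qed (auto simp: comp_zero J' distrib_right comp_add)
  have right: "x * r \<in> ?L" if x: "x \<in> ?L" for r x
  proof (induction r rule: homogeneous_induct)
    case (homogeneous a r)
    have "(\<Sum>g | component g x \<noteq> 0. component g x * r) \<in> ?L"
      using x J' comp_homogeneous[OF R_mult[OF comp_mem homogeneous]] by (intro L_sum) simp
    then show ?case by (simp add: sum_distrib_right[symmetric] sum_comp)
  qed (auto simp: comp_zero J' distrib_left comp_add)
  have "- x \<in> ?L" if x: "x \<in> ?L" for x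
  proof -
    have "component g (- x) = - component g x" for g
      using comp_add[of g x "- x"] by (simp add: comp_zero eq_neg_iff_add_eq_0 add.commute)
    then show ?thesis using x J by (auto simp: two_sided_ideal_def add_subgroup_def)
  qed
  then show "two_sided_ideal ?L"
    using left right by (auto simp: two_sided_ideal_def add_subgroup_def comp_zero comp_add J')
  show "component g x \<in> ?L" if "x \<in> ?L" for g x
    using that J' comp_homogeneous[OF comp_mem] by simp
qed

end

section \<open>The corner ring\<close>

locale cancellative_graded_ring = graded_ring +
  fixes e :: 'a and f :: 'b
  assumes R_is_zero: "\<And>\<theta>. is_zero \<theta> \<Longrightarrow> R \<theta> = {0}"
    and e_idem: "e * e = e"
    and cancel: "cancellative_at e"
    and group_e: "group (nonzero_local_monoid e)"
    and f_mem: "f \<in> R e" and f_idem: "f * f = f" and f_nonzero: "f \<noteq> 0"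
begin

text \<open>The Peirce corner \<open>f R f\<close>, described by equations, which is possible
  because \<open>f\<close> is idempotent. It agrees with the corner of \<open>R_{eGe}\<close> by
  \<open>corner_ring_local\<close>.\<close>

definition corner :: "'b set"
  where "corner = {x. f * x = x \<and> x * f = x}"

lemma f_idem_assoc: "f * (f * x) = f * x"
  by (metis f_idem mult.assoc)

lemma corner_mem: "f * x * f \<in> corner"
  by (simp add: corner_def mult.assoc f_idem f_idem_assoc)

lemma cancelD: "\<lbrakk>e * a * x * b * e = e * a * y * b * e; \<not> is_zero (e * a * x * b * e)\<rbrakk> \<Longrightarrow> x = y"
  using cancel unfolding cancellative_at_def by blast

text \<open>The non-zero element \<open>f * x * f\<close> has degree \<open>e * g * e\<close>, which
  is therefore not a zero element. Multiplication by \<open>e\<close> on both sides sends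
  \<open>g\<close> and \<open>e * g * e\<close> to the same element, so cancellativity with
  \<open>a = b = e\<close> identifies them.\<close>

lemma local_degree:
  assumes "x \<in> R g" "f * x * f \<noteq> 0"
  shows "g = e * g * e" "g \<in> carrier (nonzero_local_monoid e)"
proof -
  have "f * x * f \<in> R (e * g * e)" using assms f_mem by (intro R_mult)
  then have nz: "\<not> is_zero (e * g * e)" using assms(2) R_is_zero by force
  have ee: "e * (e * x) = e * x" for x by (metis e_idem mult.assoc)
  have "e * e * g * e * e = e * e * (e * g * e) * e * e" by (simp add: mult.assoc e_idem ee)
  moreover have "\<not> is_zero (e * e * g * e * e)" using nz by (simp add: mult.assoc e_idem ee)
  ultimately show eq: "g = e * g * e" by (rule cancelD)
  show "g \<in> carrier (nonzero_local_monoid e)"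
    using eq nz by (auto simp: nonzero_local_monoid_def local_subsemigroup_def)
qed

text \<open>For homogeneous \<open>x\<close>, the element \<open>f * x * f\<close> is zero or of the
  same degree as \<open>x\<close>, so this map commutes with the projections.\<close>

lemma comp_corner: "component g (f * x * f) = f * component g x * f"
proof (induction x rule: homogeneous_induct)
  case (homogeneous h x)
  have "f * x * f \<in> R h"
  proof (cases "f * x * f = 0")
    case False
    then have "h = e * h * e" using homogeneous local_degree by blast
    moreover have "f * x * f \<in> R (e * h * e)" using homogeneous f_mem by (intro R_mult)
    ultimately show ?thesis by simp
  qed (simp add: R_zero)
  then show ?case using homogeneous by (simp add: comp_homogeneous)
qed (auto simp: comp_zero comp_add algebra_simps)

lemma corner_eq: "x \<in> corner \<Longrightarrow> f * x * f = x"
  by (simp add: corner_def)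

lemma comp_mem_corner: "x \<in> corner \<Longrightarrow> component g x \<in> corner"
  using comp_corner[of g x] corner_mem[of "component g x"] by (simp add: corner_eq)

lemma comp_carrier: "\<lbrakk>x \<in> corner; component g x \<noteq> 0\<rbrakk> \<Longrightarrow> g \<in> carrier (nonzero_local_monoid e)"
  using local_degree(2)[OF comp_mem, of g x] corner_eq[OF comp_mem_corner, of x g] by simp

text \<open>Degrees of corner elements lie in the group by \<open>local_degree\<close>. Its identity
  is \<open>e\<close>, so \<open>f\<close>, which lies in \<open>R e\<close>, is homogeneous of
  degree one.\<close>

sublocale corner: group_graded_corner "nonzero_local_monoid e" corner f component
proof -
  interpret group "nonzero_local_monoid e" by (rule group_e)
  show "group_graded_corner (nonzero_local_monoid e) corner f component"
  proof unfold_locales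
    fix x y and k l assume "x \<in> corner" "y \<in> corner"
    then show "x * y \<in> corner"
      by (simp add: corner_def mult.assoc) (simp add: mult.assoc[symmetric])
  next
    fix x and k assume "x \<in> corner"
    then show "component k x \<in> corner" by (rule comp_mem_corner)
  next
    fix x y and k l
    show "component (k \<otimes>\<^bsub>nonzero_local_monoid e\<^esub> l) (component k x * component l y) = component k x * component l y"
      using comp_homogeneous[OF R_mult[OF comp_mem comp_mem]] by (simp add: nonzero_local_monoid_def)
  next
    show "component \<one>\<^bsub>nonzero_local_monoid e\<^esub> f = f"
      using comp_homogeneous[OF f_mem] by (simp add: nonzero_local_monoid_def)
  qed (auto simp: corner_def f_idem f_nonzero comp_add comp_finite sum_comp distrib_left distrib_right
      comp_homogeneous[OF comp_mem] intro: comp_carrier[unfolded corner_def])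
qed

text \<open>Cancellativity makes the degree map \<open>g \<mapsto> e a g b e\<close> injective off the zero element.\<close>

lemma comp_sandwich:
  assumes r: "r \<in> R a" and s: "s \<in> R b" and nz: "f * r * component g x * s * f \<noteq> 0"
  shows "f * r * component g x * s * f = component (e * a * g * b * e) (f * r * x * s * f)"
proof -
  let ?h = "e * a * g * b * e"
  have "f * r * component g x * s * f \<in> R ?h" using r s f_mem comp_mem by (intro R_mult)
  \<comment> \<open>A non-zero element cannot have a zero element as its degree; this is the side
    condition for cancelling.\<close>
  then have h: "\<not> is_zero ?h" using nz R_is_zero by force
  have "f * r * component g y * s * f = component ?h (f * r * y * s * f)" for y
  proof (induction y rule: homogeneous_induct)
    case (homogeneous k y)
    have "f * r * y * s * f \<in> R (e * a * k * b * e)" using r s f_mem homogeneous by (intro R_mult)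
    then have "component ?h (f * r * y * s * f) = (if ?h = e * a * k * b * e then f * r * y * s * f else 0)"
      by (rule comp_homogeneous)
    moreover have "?h = e * a * k * b * e \<longleftrightarrow> g = k" using cancelD[OF _ h] by auto
    ultimately show ?case using comp_homogeneous[OF homogeneous] by auto
  qed (auto simp: comp_zero comp_add algebra_simps)
  then show ?thesis .
qed

section \<open>Graded ideals of sandwich type\<close>

definition sandwich :: "'b set \<Rightarrow> 'b set"
  where "sandwich I = {x. \<forall>r s g. component g (f * r * x * s * f) \<in> I}"

text \<open>With \<open>r\<close>, \<open>s\<close> and \<open>y\<close> homogeneous the whole
  product is homogeneous, so the componentwise condition becomes plain membership in
  \<open>I\<close>.\<close>

lemma sandwichI_homogeneous:
  assumes I: "0 \<in> I" "\<And>x y. \<lbrakk>x \<in> I; y \<in> I\<rbrakk> \<Longrightarrow> x + y \<in> I" and y: "y \<in> R c"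
    and h: "\<And>r s a b. \<lbrakk>r \<in> R a; s \<in> R b\<rbrakk> \<Longrightarrow> f * r * y * s * f \<in> I"
  shows "y \<in> sandwich I"
proof -
  have "component g (f * r * y * s * f) \<in> I" for r s g
  proof (induction r rule: homogeneous_induct)
    case r: (homogeneous a r)
    show ?case
    proof (induction s rule: homogeneous_induct)
      case s: (homogeneous b s)
      have "f * r * y * s * f \<in> R (e * a * c * b * e)" using r s y f_mem by (intro R_mult)
      then show ?case using h[OF r s] I(1) by (simp add: comp_homogeneous)
    qed (auto simp: comp_zero comp_add distrib_left distrib_right I)
  qed (auto simp: comp_zero comp_add distrib_left distrib_right I)
  then show ?thesis by (simp add: sandwich_def)
qed

text \<open>Outer factors are absorbed into \<open>r\<close> and \<open>s\<close>, and signs into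
  \<open>r\<close>. The ideal is graded by \<open>comp_sandwich\<close>: for homogeneous
  \<open>r\<close> and \<open>s\<close>, sandwiching a component of \<open>x\<close> gives zero or a
  component of \<open>f * r * x * s * f\<close>.\<close>

lemma graded_ideal_sandwich:
  assumes I: "0 \<in> I" "\<And>x y. \<lbrakk>x \<in> I; y \<in> I\<rbrakk> \<Longrightarrow> x + y \<in> I"
  shows "graded_ideal R (sandwich I)"
proof (rule graded_idealI)
  show "two_sided_ideal (sandwich I)"
    unfolding two_sided_ideal_def add_subgroup_def
  proof (intro conjI ballI allI)
    show "0 \<in> sandwich I" using I by (simp add: sandwich_def comp_zero)
    fix x assume x: "x \<in> sandwich I"
    then have x': "component g (f * r * x * s * f) \<in> I" for g r s by (simp add: sandwich_def)
    show "- x \<in> sandwich I" using x'[of _ "- _"] by (simp add: sandwich_def)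
    show "r * x \<in> sandwich I" for r using x'[of _ "_ * r"] by (simp add: sandwich_def mult.assoc)
    show "x * r \<in> sandwich I" for r using x'[of _ _ "r * _"] by (simp add: sandwich_def mult.assoc)
    show "x + y \<in> sandwich I" if "y \<in> sandwich I" for y
      using that x I by (auto simp: sandwich_def comp_add distrib_left distrib_right)
  qed
next
  fix g x assume x: "x \<in> sandwich I"
  show "component g x \<in> sandwich I"
  proof (rule sandwichI_homogeneous[OF I comp_mem])
    fix r s a b assume rs: "r \<in> R a" "s \<in> R b"
    show "f * r * component g x * s * f \<in> I"
    proof (cases "f * r * component g x * s * f = 0")
      case False
      show ?thesis unfolding comp_sandwich[OF rs False] using x by (simp add: sandwich_def)
    qed (simp add: I)
  qed
qed

section \<open>From graded simplicity to simplicity\<close>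

lemma corner_homogeneous_simple:
  assumes gs: "graded_simple R"
  shows "corner.homogeneous_simple"
  unfolding corner.homogeneous_simple_def
proof (intro allI impI, elim conjE)
  fix I x k assume I: "corner.ideal_of I" and x: "x \<in> corner" "component k x \<noteq> 0" "component k x \<in> I"
  note I' = corner.ideal_ofD[OF I]
  \<comment> \<open>This non-zero element forces the graded ideal \<open>sandwich I\<close> to be
    the whole ring.\<close>
  have "component k x \<in> sandwich I"
  proof (rule sandwichI_homogeneous[OF _ _ comp_mem])
    show "0 \<in> I" "\<And>x y. \<lbrakk>x \<in> I; y \<in> I\<rbrakk> \<Longrightarrow> x + y \<in> I" using I' by auto
    fix r s a b
    have "(f * r * f) * component k x * (f * s * f) \<in> I" 
      using I'(5)[OF I'(4)[OF x(3) corner_mem] corner_mem] .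
    moreover have "(f * r * f) * component k x * (f * s * f) = f * r * (f * component k x * f) * s * f"
      by (simp add: mult.assoc)
    ultimately show "f * r * component k x * s * f \<in> I" using corner_eq comp_mem_corner x(1) by simp
  qed
  moreover have "sandwich I = {0} \<or> sandwich I = UNIV"
    using gs graded_ideal_sandwich[of I] I' by (simp add: graded_simple_def)
  ultimately have "f \<in> sandwich I" using x(2) by auto
  \<comment> \<open>For \<open>r = s = f\<close> the product is \<open>f\<close> itself, which is
    homogeneous of degree \<open>e\<close>.\<close>
  then have "component e (f * f * f * f * f) \<in> I" unfolding sandwich_def by blast
  then show "f \<in> I" using comp_homogeneous[OF f_mem] by (simp add: f_idem)
qed

lemma simple_if_graded_simple:
  assumes gs: "graded_simple R" and hyper: "hypercentral_group (nonzero_local_monoid e)"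
    and cen: "\<And>z. \<lbrakk>z \<in> corner; z \<noteq> 0; \<And>s. s \<in> corner \<Longrightarrow> z * s = s * z\<rbrakk> \<Longrightarrow> \<exists>w\<in>corner. z * w = f"
  shows "simple_ring TYPE('b)"
  unfolding simple_ring_def
proof (intro allI impI)
  fix J :: "'b set" assume J: "two_sided_ideal J"
  have J': "0 \<in> J" "\<And>x y. \<lbrakk>x \<in> J; y \<in> J\<rbrakk> \<Longrightarrow> x + y \<in> J"
      "\<And>r x. x \<in> J \<Longrightarrow> r * x \<in> J" "\<And>r x. x \<in> J \<Longrightarrow> x * r \<in> J"
    using J by (auto simp: two_sided_ideal_def add_subgroup_def)
  show "J = {0} \<or> J = UNIV"
  proof (cases "J = {0}")
    case False
    then obtain x where x: "x \<in> J" "x \<noteq> 0" using J'(1) by blast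
    \<comment> \<open>The ideal \<open>sandwich {0}\<close> consists of the \<open>x\<close> with
      \<open>f R x R f = 0\<close>. It misses \<open>f\<close>, so it vanishes, and each non-zero
      \<open>x\<close> has a non-zero multiple in the corner.\<close>
    have "f \<notin> sandwich {0}"
    proof
      assume "f \<in> sandwich {0}"
      then have "component e (f * f * f * f * f) = 0" unfolding sandwich_def by blast
      then show False using comp_homogeneous[OF f_mem] f_nonzero by (simp add: f_idem)
    qed
    then have "sandwich {0} = {0}"
      using gs graded_ideal_sandwich[of "{0}"] by (auto simp: graded_simple_def)
    then have "x \<notin> sandwich {0}" using x(2) by simp
    then obtain r s g where rs: "component g (f * r * x * s * f) \<noteq> 0" by (auto simp: sandwich_def)
    define y where "y = f * r * x * s * f"
    have y: "y \<in> corner \<inter> J" "y \<noteq> 0"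
      using rs x(1) corner_mem[of "r * x * s"] J' by (auto simp: y_def mult.assoc comp_zero)
    have "corner.ideal_of (corner \<inter> J)"
      using J' corner.S_zero corner.S_add corner.S_mult by (auto simp: corner.ideal_of_def)
    then have "f \<in> corner \<inter> J"
      using corner.unit_mem_nonzero_ideal[OF hyper corner_homogeneous_simple[OF gs] cen _ y] by blast
    then have "f \<in> {x. \<forall>g. component g x \<in> J}" using J'(1) by (simp add: comp_homogeneous[OF f_mem])
    then have all: "{x. \<forall>g. component g x \<in> J} = UNIV"
      using gs graded_ideal_comps[OF J] f_nonzero by (auto simp: graded_simple_def)
    have J_sum: "sum c A \<in> J" if "\<And>g. c g \<in> J" for c :: "'a \<Rightarrow> 'b" and A
      using that by (induction A rule: infinite_finite_induct) (auto simp: J')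
    have "x \<in> J" for x
      using J_sum[of "\<lambda>g. component g x" "{g. component g x \<noteq> 0}"] all sum_comp[of x] by auto
    then show ?thesis by blast
  qed simp
qed

section \<open>Central elements of the corner of a simple ring\<close>

lemma central_unit_if_simple:
  assumes simple: "simple_ring TYPE('b)"
    and z: "z \<in> corner" "z \<noteq> 0" "\<And>s. s \<in> corner \<Longrightarrow> z * s = s * z"
  shows "\<exists>w\<in>corner. z * w = f"
proof -
  \<comment> \<open>The multiples of the central element \<open>z\<close> form an ideal of the
    corner; \<open>L\<close> lifts it to the whole ring.\<close>
  define L where "L = {x. \<forall>r s. \<exists>w\<in>corner. f * r * x * s * f = z * w}"
  have "two_sided_ideal L"
    unfolding two_sided_ideal_def add_subgroup_def
  proof (intro conjI ballI allI)
    show "0 \<in> L" using corner.S_zero by (auto simp: L_def intro!: bexI[of _ 0])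
    fix x assume x: "x \<in> L"
    then have x': "\<exists>w\<in>corner. f * r * x * s * f = z * w" for r s by (simp add: L_def)
    show "- x \<in> L" using x'[of "- _"] by (simp add: L_def)
    show "r * x \<in> L" for r using x'[of "_ * r"] by (simp add: L_def mult.assoc)
    show "x * r \<in> L" for r using x'[of _ "r * _"] by (simp add: L_def mult.assoc)
    show "x + y \<in> L" if y: "y \<in> L" for y
      unfolding L_def
    proof (intro CollectI allI)
      fix r s
      obtain v w where "v \<in> corner" "w \<in> corner" "f * r * x * s * f = z * v" "f * r * y * s * f = z * w"
        using x' y by (auto simp: L_def) blast
      then show "\<exists>w\<in>corner. f * r * (x + y) * s * f = z * w"
        by (intro bexI[of _ "v + w"]) (auto simp: distrib_left distrib_right corner.S_add)
    qed
  qed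
  moreover have "z \<in> L" unfolding L_def
  proof (intro CollectI allI)
    fix r s
    have "f * r * z * s * f = (f * r * f) * z * (f * s * f)"
      using corner_eq[OF z(1)] by (metis mult.assoc)
    also have "\<dots> = z * (f * r * f) * (f * s * f)" by (simp only: z(3)[OF corner_mem])
    also have "\<dots> = z * ((f * r * f) * (f * s * f))" by (rule mult.assoc)
    finally show "\<exists>w\<in>corner. f * r * z * s * f = z * w" using corner_mem corner.S_mult by blast
  qed
  ultimately have "f \<in> L" using simple z(2) by (auto simp: simple_ring_def)
  \<comment> \<open>Taking \<open>r = s = f\<close> turns membership of \<open>f\<close> in
    \<open>L\<close> into invertibility of \<open>z\<close>.\<close>
  then have "\<exists>w\<in>corner. f * f * f * f * f = z * w" unfolding L_def by blast
  then show ?thesis by (auto simp: f_idem)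
qed

section \<open>The center of the corner as a field\<close>

lemma corner_ring_local:
  "corner_ring f (sum_of_family R (local_subsemigroup e)) =
    \<lparr>carrier = corner, mult = (*), one = f, zero = 0, add = (+)\<rparr>"
proof -
  have "x \<in> sum_of_family R (local_subsemigroup e)" if "x \<in> corner" for x
  proof -
    \<comment> \<open>Components of corner elements have degrees in \<open>eGe\<close>, so
      restricting to \<open>R_{eGe}\<close> loses nothing of \<open>f R f\<close>.\<close>
    have "(\<lambda>g. component g x) \<in> finsupp_families R (local_subsemigroup e)"
      using comp_carrier[OF that] comp_mem comp_finite
      by (auto simp: finsupp_families_def nonzero_local_monoid_def)
    then show ?thesis using Sum_any_comp[of x] unfolding sum_of_family_def by (metis imageI)
  qed
  then have "{f * r * f |r. r \<in> sum_of_family R (local_subsemigroup e)} = corner"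
    using corner_mem corner_eq by (auto, metis)
  then show ?thesis by (simp add: corner_ring_def)
qed

text \<open>The center is a commutative ring with identity \<open>f\<close>, and an inverse in the
  corner of a central element is itself central. Hence the field property is the existence of
  inverses in the corner.\<close>

lemma field_center_corner_iff:
  "field (center_ring (corner_ring f (sum_of_family R (local_subsemigroup e)))) \<longleftrightarrow>
    (\<forall>z\<in>corner. z \<noteq> 0 \<and> (\<forall>s\<in>corner. z * s = s * z) \<longrightarrow> (\<exists>w\<in>corner. z * w = f))"
    (is "field ?C \<longleftrightarrow> ?unit")
proof -
  define Z where "Z = {z \<in> corner. \<forall>x\<in>corner. z * x = x * z}"
  have C: "?C = \<lparr>carrier = Z, mult = (*), one = f, zero = 0, add = (+)\<rparr>"
    by (simp add: corner_ring_local center_ring_def center_def Z_def)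
  show ?thesis
  proof
    assume F: "field ?C"
    show ?unit
    proof (intro ballI impI, elim conjE)
      fix z assume "z \<in> corner" "z \<noteq> 0" "\<forall>s\<in>corner. z * s = s * z"
      then have "z \<in> Units ?C" using field.field_Units[OF F] by (simp add: C Z_def)
      then show "\<exists>w\<in>corner. z * w = f" by (auto simp: Units_def C Z_def)
    qed
  next
    assume unit: ?unit
    have Z: "z \<in> corner" if "z \<in> Z" for z using that by (simp add: Z_def)
    have comm: "z * x = x * z" if "z \<in> Z" "x \<in> corner" for z x using that by (simp add: Z_def)
    have Z_mult: "x * y \<in> Z" if "x \<in> Z" "y \<in> Z" for x y
    proof -
      have "x * y * s = s * (x * y)" if s: "s \<in> corner" for s
      proof -
        have "x * y * s = x * (s * y)" using comm[OF \<open>y \<in> Z\<close> s] by (simp only: mult.assoc)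
        also have "\<dots> = s * x * y" using comm[OF \<open>x \<in> Z\<close> s] by (simp only: mult.assoc[symmetric])
        finally show ?thesis by (simp only: mult.assoc)
      qed
      moreover have "x * y \<in> corner" using that by (intro corner.S_mult Z)
      ultimately show ?thesis unfolding Z_def by blast
    qed
    have Z_unit: "f \<in> Z" by (simp add: Z_def corner.S_unit corner.unit_left corner.unit_right)
    let ?Z = "\<lparr>carrier = Z, mult = (*), one = f, zero = 0, add = (+)\<rparr>"
    have cr: "cring ?C" unfolding C
    proof (rule cringI)
      show "abelian_group ?Z"
      proof (rule abelian_groupI)
        fix x assume "x \<in> carrier ?Z"
        then show "\<exists>y\<in>carrier ?Z. y \<oplus>\<^bsub>?Z\<^esub> x = \<zero>\<^bsub>?Z\<^esub>"
          by (intro bexI[of _ "- x"]) (simp_all add: Z_def corner.S_uminus)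
      qed (simp_all add: Z_def corner.S_add corner.S_zero distrib_left distrib_right add.assoc add.commute)
      show "comm_monoid ?Z"
      proof (rule comm_monoidI)
        fix x y assume "x \<in> carrier ?Z" "y \<in> carrier ?Z"
        then show "x \<otimes>\<^bsub>?Z\<^esub> y = y \<otimes>\<^bsub>?Z\<^esub> x" using comm[of x y] Z by simp
      qed (simp_all add: Z_mult Z_unit mult.assoc Z corner.unit_left)
    qed (simp add: distrib_right)
    have "Units ?C = Z - {0}"
    proof
      show "Units ?C \<subseteq> Z - {0}" using f_nonzero by (auto simp: Units_def C)
      show "Z - {0} \<subseteq> Units ?C"
      proof
        fix z assume z: "z \<in> Z - {0}"
        then obtain w where w: "w \<in> corner" "z * w = f" using unit unfolding Z_def by blast
        have wz: "w * z = f" using comm[of z w] z w by simp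
        have "w * s = s * w" if s: "s \<in> corner" for s
        proof -
          \<comment> \<open>The identity \<open>f = z * w\<close> is inserted on the right, so that
            \<open>z\<close> can move past \<open>s\<close> and cancel against the first
            \<open>w\<close>.\<close>
          have "w * s = w * (s * z) * w" using w s by (simp add: mult.assoc corner.unit_right)
          also have "\<dots> = w * (z * s) * w" using comm[of z s] z s by simp
          also have "\<dots> = (w * z) * (s * w)" by (simp only: mult.assoc)
          also have "\<dots> = s * w" using wz s w by (simp add: corner.unit_left corner.S_mult)
          finally show ?thesis .
        qed
        then have "w \<in> Z" using w(1) unfolding Z_def by blast
        then show "z \<in> Units ?C" using z w wz by (auto simp: Units_def C)
      qed
    qed
    then show "field ?C" using cring.cring_fieldI[OF cr] by (simp add: C)
  qed
qed

end

theorem theorem2: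
  fixes R :: "'g::semigroup_mult \<Rightarrow> 'r::ring set"
    and e :: 'g and f :: 'r
  assumes "grading R"
    and "\<And>\<theta>. is_zero \<theta> \<Longrightarrow> R \<theta> = {0}"
    and "e * e = e" and "\<not> is_zero e"
    and "cancellative_at e"
    and "hypercentral_group (nonzero_local_monoid e)"
    and "f \<in> R e" and "f * f = f" and "f \<noteq> 0"
  shows "simple_ring TYPE('r) \<longleftrightarrow>
    graded_simple R \<and>
    field (center_ring (corner_ring f (sum_of_family R (local_subsemigroup e))))"
proof -
  interpret cancellative_graded_ring R e f
  proof (intro cancellative_graded_ring.intro graded_ring.intro cancellative_graded_ring_axioms.intro)
    show "group (nonzero_local_monoid e)" using assms(6) unfolding hypercentral_group_def by blast
  qed (use assms in blast)+
  show ?thesis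
  proof
    assume simple: "simple_ring TYPE('r)"
    then have "graded_simple R" by (simp add: simple_ring_def graded_simple_def graded_ideal_def)
    then show "graded_simple R \<and>
        field (center_ring (corner_ring f (sum_of_family R (local_subsemigroup e))))"
      using central_unit_if_simple[OF simple] by (auto simp: field_center_corner_iff)
  next
    assume "graded_simple R \<and>
        field (center_ring (corner_ring f (sum_of_family R (local_subsemigroup e))))"
    then show "simple_ring TYPE('r)"
      using assms(6) by (intro simple_if_graded_simple) (auto simp: field_center_corner_iff)
  qed
qed

end
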